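(* Let $n\ge 1$ and let $F_n$ be the friendship graph with center $c$ and $3$-cycles $T_i=(c,a_i,b_i)$ for $i=1,\dots,n$. Then its visibility polynomial is $$\mathcal{V}(F_n)=(1+x)^{2n}+x+2n\,x^2+n\,x^3 .$$
   Context: Graphs are finite, simple, undirected and connected. For $X\subseteq V(G)$, two vertices $u,v\in V(G)$ are $X$-visible if there is a shortest $(u,v)$-path $P$ in $G$ with $V(P)\cap X\subseteq\{u,v\}$. A set $X\subseteq V(G)$ is a mutual-visibility set of $G$ if every pair of vertices of $X$ is $X$-visible (in particular the empty set and singletons are mutual-visibility sets). The visibility polynomial of $G$ is $\mathcal{V}(G)=\sum_{i\ge 0} r_i x^i$, where $r_i$ is the number of mutual-visibility sets of $G$ of cardinality $i$ (so $r_0=1$). The friendship graph $F_n$ is formed by $n$ $3$-cycles having exactly one vertex in common, called the center $c$; it has $2n+1$ vertices $c,a_1,b_1,\dots,a_n,b_n$ and edges $ca_i$, $cb_i$, $a_ib_i$ for $1\le i\le n$. *)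

theory Defs
  imports
    "Graph_Theory.Graph_Theory"
    "HOL-Computational_Algebra.Polynomial"
begin

text \<open>Undirected graphs are symmetric digraphs, as in locale \<open>graph\<close>. Paths are lists of vertices.\<close>

definition path_between :: "('a, 'b) pre_digraph \<Rightarrow> 'a \<Rightarrow> 'a vwalk \<Rightarrow> 'a \<Rightarrow> bool" where
  "path_between G u p v \<longleftrightarrow> vpath p G \<and> hd p = u \<and> last p = v"

definition shortest_path :: "('a, 'b) pre_digraph \<Rightarrow> 'a \<Rightarrow> 'a vwalk \<Rightarrow> 'a \<Rightarrow> bool" where
  "shortest_path G u p v \<longleftrightarrow>
     path_between G u p v \<and> (\<forall>q. path_between G u q v \<longrightarrow> vwalk_length p \<le> vwalk_length q)"

definition visible :: "('a, 'b) pre_digraph \<Rightarrow> 'a set \<Rightarrow> 'a \<Rightarrow> 'a \<Rightarrow> bool" where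
  "visible G X u v \<longleftrightarrow> (\<exists>p. shortest_path G u p v \<and> set p \<inter> X \<subseteq> {u, v})"

definition mutual_visibility_set :: "('a, 'b) pre_digraph \<Rightarrow> 'a set \<Rightarrow> bool" where
  "mutual_visibility_set G X \<longleftrightarrow> X \<subseteq> verts G \<and> (\<forall>u\<in>X. \<forall>v\<in>X. visible G X u v)"

definition num_mutual_visibility_sets :: "('a, 'b) pre_digraph \<Rightarrow> nat \<Rightarrow> nat" where
  "num_mutual_visibility_sets G i = card {X. mutual_visibility_set G X \<and> card X = i}"

text \<open>No coefficient is lost by stopping at the order of the graph, see
  \<open>coeff_visibility_polynomial\<close> below.\<close>

definition visibility_polynomial :: "('a, 'b) pre_digraph \<Rightarrow> int poly" where
  "visibility_polynomial G =
     (\<Sum>i\<le>card (verts G). monom (int (num_mutual_visibility_sets G i)) i)"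

lemma coeff_visibility_polynomial:
  assumes "finite (verts G)"
  shows "coeff (visibility_polynomial G) i = int (num_mutual_visibility_sets G i)"
proof (cases "i \<le> card (verts G)")
  case True
  then show ?thesis
    by (simp add: visibility_polynomial_def coeff_sum)
next
  case False
  then have "{X. mutual_visibility_set G X \<and> card X = i} = {}"
    using assms by (auto simp: mutual_visibility_set_def dest: card_mono)
  then have "num_mutual_visibility_sets G i = 0"
    unfolding num_mutual_visibility_sets_def by (simp only: card.empty)
  with False show ?thesis
    by (simp add: visibility_polynomial_def coeff_sum)
qed

datatype friendship_vertex = Center | A nat | B nat

definition friendship_graph :: "nat \<Rightarrow> friendship_vertex pair_pre_digraph" where
  "friendship_graph n =
     \<lparr> pverts = insert Center (A ` {1..n} \<union> B ` {1..n}),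
       parcs = (\<Union>i\<in>{1..n}. {(Center, A i), (A i, Center), (Center, B i), (B i, Center),
                           (A i, B i), (B i, A i)}) \<rparr>"

lemma pair_graph_friendship_graph: "pair_graph (friendship_graph n)"
  by unfold_locales (auto simp: friendship_graph_def arcs_ends_def symmetric_def sym_def)

lemma card_verts_friendship_graph: "card (verts (friendship_graph n)) = 2 * n + 1"
proof -
  have "card (A ` {1..n} \<union> B ` {1..n}) = n + n"
    by (subst card_Un_disjoint) (auto simp: card_image inj_on_def)
  then show ?thesis
    by (auto simp: friendship_graph_def card_insert_if)
qed

lemma connected_friendship_graph: "connected (friendship_graph n)"
proof -
  interpret pair_graph "friendship_graph n"
    by (rule pair_graph_friendship_graph)
  let ?G = "with_proj (friendship_graph n)"
  have *: "v \<rightarrow>\<^sup>*\<^bsub>?G\<^esub> Center \<and> Center \<rightarrow>\<^sup>*\<^bsub>?G\<^esub> v" if "v \<in> verts ?G" for v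
  proof (cases "v = Center")
    case True
    with that show ?thesis by auto
  next
    case False
    with that have "v \<rightarrow>\<^bsub>?G\<^esub> Center" "Center \<rightarrow>\<^bsub>?G\<^esub> v"
      by (auto simp: friendship_graph_def arcs_ends_def arc_to_ends_def)
    then show ?thesis by auto
  qed
  have "strongly_connected ?G"
    unfolding strongly_connected_def
  proof (intro conjI ballI)
    show "verts ?G \<noteq> {}"
      by (simp add: friendship_graph_def)
    show "u \<rightarrow>\<^sup>*\<^bsub>?G\<^esub> v" if "u \<in> verts ?G" "v \<in> verts ?G" for u v
      using *[OF that(1)] *[OF that(2)] reachable_trans by blast
  qed
  then show ?thesis
    unfolding connected_def strongly_connected_def
    by (auto intro!: reachable_mk_symmetricI)
qed

end

theory Submission
  imports Defs
begin

text \<open>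
  Two distinct outer vertices are adjacent or have \<open>Center\<close> as their only common neighbour, so every
  set of outer vertices is a mutual-visibility set; these sets contribute \<open>(1 + x) ^ (2 * n)\<close>.
  A mutual-visibility set containing \<open>Center\<close> cannot contain two nonadjacent outer vertices, so
  apart from \<open>Center\<close> it has nothing, one outer vertex, or the two outer vertices of one triangle;
  these sets contribute \<open>x\<close>, \<open>2 n x\<^sup>2\<close> and \<open>n x\<^sup>3\<close>.
\<close>

lemma path_between_refl:
  assumes "u \<in> verts G"
  shows "path_between G u [u] u"
  using assms by (auto simp: path_between_def vpath_def vwalk_def)

lemma visible_refl:
  assumes "u \<in> verts G"
  shows "visible G X u u"
  unfolding visible_def shortest_path_def
  using path_between_refl[OF assms] by (intro exI[of _ "[u]"]) auto

text \<open>Distances up to 2 are all that matters for the friendship graph, so longer paths are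
  only bounded from below. Here \<open>length\<close> counts vertices, one more than the number of
  arcs, so the last case means at least three arcs.\<close>

lemma path_between_length_cases:
  assumes "path_between G u p v" "u \<noteq> v"
  obtains "p = [u, v]" "u \<rightarrow>\<^bsub>G\<^esub> v"
  | w where "p = [u, w, v]" "w \<noteq> u" "w \<noteq> v" "u \<rightarrow>\<^bsub>G\<^esub> w" "w \<rightarrow>\<^bsub>G\<^esub> v"
  | "length p \<ge> 4"
proof -
  consider "p = []" | a where "p = [a]" | a b where "p = [a, b]"
    | a b c where "p = [a, b, c]" | "length p \<ge> 4"
  \<comment> \<open>This rule serves only to split a list into empty, singleton, and at least two
    entries; applied again to the tail it isolates lists of length 3.\<close>
  proof (cases p rule: remdups_adj.cases)
    case (3 a b xs)
    then show thesis
      using that by (cases xs rule: remdups_adj.cases) auto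
  qed (use that in auto)
  then show thesis
    using assms that by cases (auto simp: path_between_def vpath_def vwalk_def)
qed

context loopfree_digraph
begin

text \<open>The arc itself is a shortest path and has no interior vertex that could lie in
  \<open>X\<close>.\<close>

lemma visible_adjacent:
  assumes "u \<rightarrow> v"
  shows "visible G X u v"
proof -
  have "u \<noteq> v"
    using assms by (auto dest: adj_not_same)
  then have "length q \<ge> 2" if "path_between G u q v" for q
    using that by (auto elim: path_between_length_cases)
  moreover have "path_between G u [u, v] v"
    using vpathI_arc[OF assms] by (simp add: path_between_def)
  ultimately show ?thesis
    unfolding visible_def shortest_path_def by (intro exI[of _ "[u, v]"]) force
qed

text \<open>The vertex \<open>w\<close> witnesses that the distance is exactly 2. Hence the shortest
  paths are precisely the \<open>[u, z, v]\<close> through a common neighbour \<open>z\<close>, and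
  \<open>z\<close> is the only vertex that has to avoid \<open>X\<close>.\<close>

lemma visible_iff_common_neighbour:
  assumes "u \<noteq> v" "\<not> u \<rightarrow> v" "u \<rightarrow> w" "w \<rightarrow> v"
  shows "visible G X u v \<longleftrightarrow> (\<exists>z. z \<notin> X \<and> u \<rightarrow> z \<and> z \<rightarrow> v)"
proof -
  have path: "path_between G u [u, z, v] v" if "u \<rightarrow> z" "z \<rightarrow> v" for z
    using that assms(1) adj_in_verts adj_not_same
    by (auto simp: path_between_def vpath_def vwalk_def)
  have long: "length q \<ge> 3" if "path_between G u q v" for q
    using that assms by (auto elim: path_between_length_cases)
  show ?thesis
  proof
    assume "visible G X u v"
    then obtain p where p: "shortest_path G u p v" "set p \<inter> X \<subseteq> {u, v}"
      by (auto simp: visible_def)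
    \<comment> \<open>A shortest path is no longer than the detour \<open>[u, w, v]\<close>.\<close>
    have "length p \<le> 3"
      using p(1) path[OF assms(3,4)] by (fastforce simp: shortest_path_def)
    then obtain z where "p = [u, z, v]" "z \<noteq> u" "z \<noteq> v" "u \<rightarrow> z" "z \<rightarrow> v"
      using p(1) assms(1,2)
      by (auto simp: shortest_path_def elim!: path_between_length_cases)
    then show "\<exists>z. z \<notin> X \<and> u \<rightarrow> z \<and> z \<rightarrow> v"
      using p(2) by auto
  next
    assume "\<exists>z. z \<notin> X \<and> u \<rightarrow> z \<and> z \<rightarrow> v"
    then obtain z where z: "z \<notin> X" "u \<rightarrow> z" "z \<rightarrow> v"
      by auto
    show "visible G X u v"
      unfolding visible_def shortest_path_def
      using path[OF z(2,3)] long z(1) by (intro exI[of _ "[u, z, v]"]) force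
  qed
qed

end

text \<open>Summing over the sets themselves instead of their sizes lets a classification of the
  sets split the polynomial directly. Coefficient \<open>i\<close> of the sum counts the sets of
  size \<open>i\<close>.\<close>

lemma visibility_polynomial_eq_sum:
  assumes "finite (verts G)"
  shows "visibility_polynomial G = (\<Sum>X | mutual_visibility_set G X. monom 1 (card X))"
proof (rule poly_eqI)
  fix i
  have "finite {X. mutual_visibility_set G X}"
    by (rule finite_subset[of _ "Pow (verts G)"]) (auto simp: mutual_visibility_set_def assms)
  then have "(\<Sum>X | mutual_visibility_set G X. if card X = i then 1 else 0) =
      int (card {X. mutual_visibility_set G X \<and> card X = i})"
    by (simp add: sum.If_cases Collect_conj_eq)
  then show "coeff (visibility_polynomial G) i =
      coeff (\<Sum>X | mutual_visibility_set G X. monom 1 (card X)) i"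
    by (simp add: coeff_visibility_polynomial assms coeff_sum num_mutual_visibility_sets_def)
qed

text \<open>Expanding the product of the factors \<open>x + 1\<close> over \<open>S\<close>, each
  subset records the factors from which \<open>x\<close> is chosen.\<close>

lemma sum_power_card_Pow:
  fixes x :: "'b :: comm_semiring_1"
  assumes "finite S"
  shows "(\<Sum>X\<in>Pow S. x ^ card X) = (1 + x) ^ card S"
  using prod_add[OF assms, of "\<lambda>_. x" "\<lambda>_. 1"] by (simp add: add.commute)

definition outer_vertices :: "nat \<Rightarrow> friendship_vertex set" where
  "outer_vertices n = A ` {1..n} \<union> B ` {1..n}"

lemma finite_outer_vertices: "finite (outer_vertices n)"
  by (simp add: outer_vertices_def)

lemma Center_notin_outer_vertices: "Center \<notin> outer_vertices n"
  by (auto simp: outer_vertices_def)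

lemma verts_friendship_graph: "verts (friendship_graph n) = insert Center (outer_vertices n)"
  by (simp add: friendship_graph_def outer_vertices_def)

lemma card_outer_vertices: "card (outer_vertices n) = 2 * n"
  using card_verts_friendship_graph[of n] Center_notin_outer_vertices[of n]
  by (simp add: verts_friendship_graph finite_outer_vertices del: with_proj_simps)

lemma friendship_graph_adjacent_iff:
  "u \<rightarrow>\<^bsub>friendship_graph n\<^esub> v \<longleftrightarrow>
     u = Center \<and> v \<in> outer_vertices n \<or> u \<in> outer_vertices n \<and> v = Center \<or>
     (\<exists>i\<in>{1..n}. u = A i \<and> v = B i \<or> u = B i \<and> v = A i)"
  by (auto simp: friendship_graph_def outer_vertices_def arcs_ends_def arc_to_ends_def)

lemma loopfree_digraph_friendship_graph: "loopfree_digraph (friendship_graph n)"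
proof -
  interpret pair_graph "friendship_graph n"
    by (rule pair_graph_friendship_graph)
  show ?thesis
    by unfold_locales
qed

lemma visible_friendship_graph_iff:
  assumes "u \<in> verts (friendship_graph n)" "v \<in> verts (friendship_graph n)"
  shows "visible (friendship_graph n) X u v \<longleftrightarrow>
    u = v \<or> u \<rightarrow>\<^bsub>friendship_graph n\<^esub> v \<or> Center \<notin> X"
proof -
  interpret loopfree_digraph "friendship_graph n"
    by (rule loopfree_digraph_friendship_graph)
  show ?thesis
  proof (cases "u = v \<or> u \<rightarrow>\<^bsub>friendship_graph n\<^esub> v")
    case True
    then show ?thesis
      using visible_refl[OF assms(1)] visible_adjacent by blast
  next
    case False
    then have "u \<in> outer_vertices n" "v \<in> outer_vertices n"
      using assms unfolding verts_friendship_graph friendship_graph_adjacent_iff by auto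
    then have c: "u \<rightarrow>\<^bsub>friendship_graph n\<^esub> Center" "Center \<rightarrow>\<^bsub>friendship_graph n\<^esub> v"
      unfolding friendship_graph_adjacent_iff by simp_all
    \<comment> \<open>An outer \<open>z\<close> has a single outer neighbour, its partner in the
      triangle, which would force \<open>u = v\<close>.\<close>
    have "z = Center" if "u \<rightarrow>\<^bsub>friendship_graph n\<^esub> z" "z \<rightarrow>\<^bsub>friendship_graph n\<^esub> v" for z
      using that False unfolding friendship_graph_adjacent_iff
      by (auto simp: outer_vertices_def)
    then show ?thesis
      using visible_iff_common_neighbour[OF _ _ c, of X] False c by auto
  qed
qed

lemma mutual_visibility_set_friendship_graph_iff:
  "mutual_visibility_set (friendship_graph n) X \<longleftrightarrow>
     X \<subseteq> outer_vertices n \<or> X = {Center} \<or> (\<exists>v\<in>outer_vertices n. X = {Center, v}) \<or>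
     (\<exists>i\<in>{1..n}. X = {Center, A i, B i})"
  (is "?mv \<longleftrightarrow> ?R")
proof -
  \<comment> \<open>Without \<open>Center\<close> the pairwise condition is vacuous; with
    \<open>Center\<close> in \<open>X\<close> it says that \<open>X\<close> is a clique.\<close>
  have mv: "?mv \<longleftrightarrow> X \<subseteq> insert Center (outer_vertices n) \<and>
      (\<forall>u\<in>X. \<forall>v\<in>X. u = v \<or> u \<rightarrow>\<^bsub>friendship_graph n\<^esub> v \<or> Center \<notin> X)"
    unfolding mutual_visibility_set_def verts_friendship_graph[symmetric]
    using visible_friendship_graph_iff by blast
  show ?thesis
  proof
    assume ?mv
    then have sub: "X \<subseteq> insert Center (outer_vertices n)"
      and vis: "\<And>u v. u \<in> X \<Longrightarrow> v \<in> X \<Longrightarrow> u = v \<or> u \<rightarrow>\<^bsub>friendship_graph n\<^esub> v \<or> Center \<notin> X"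
      unfolding mv by auto
    consider "Center \<notin> X" | "X = {Center}" | "Center \<in> X" "X \<noteq> {Center}"
      by auto
    then show ?R
    proof cases
      case 3
      then obtain v where v: "v \<in> X" "v \<noteq> Center"
        by auto
      then obtain i where i: "i \<in> {1..n}" "v = A i \<or> v = B i"
        using sub by (auto simp: outer_vertices_def)
      \<comment> \<open>Since \<open>Center\<close> is in \<open>X\<close>, \<open>w\<close> equals
        \<open>v\<close> or is adjacent to it, and all neighbours of \<open>v\<close> lie in its own
        triangle.\<close>
      have "w \<in> {Center, A i, B i}" if "w \<in> X" for w
        using vis[OF v(1) that] i(2) 3(1) unfolding friendship_graph_adjacent_iff by auto
      then have "X = {Center, v} \<or> X = {Center, A i, B i}"
        using v i(2) 3(1) by blast
      moreover have "v \<in> outer_vertices n"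
        using v sub by auto
      ultimately show ?thesis
        using i(1) by blast
    qed (use sub in auto)
  next
    assume ?R
    then show ?mv
      unfolding mv friendship_graph_adjacent_iff using Center_notin_outer_vertices[of n]
      by (auto simp: outer_vertices_def)
  qed
qed

theorem theorem11:
  fixes n :: nat
  assumes "n \<ge> 1"
  shows "visibility_polynomial (friendship_graph n) =
    (1 + [:0, 1:]) ^ (2 * n) + [:0, 1:] + of_nat (2 * n) * [:0, 1:] ^ 2 + of_nat n * [:0, 1:] ^ 3"
proof -
  let ?L = "outer_vertices n"
  let ?x = "[:0, 1:] :: int poly"
  let ?P = "(\<lambda>v. {Center, v}) ` ?L"
  let ?T = "(\<lambda>i. {Center, A i, B i}) ` {1..n}"
  \<comment> \<open>Otherwise \<open>v\<close> would equal both \<open>A i\<close> and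
    \<open>B i\<close>. The remaining overlaps are excluded below because \<open>Center\<close> is
    not an outer vertex.\<close>
  have "{Center, A i, B i} \<noteq> {Center, v}" for i v
  proof
    assume "{Center, A i, B i} = {Center, v}"
    then have "A i \<in> {Center, v}" "B i \<in> {Center, v}"
      by blast+
    then show False
      by auto
  qed
  then have disjoint: "Pow ?L \<inter> {{Center}} = {}" "(Pow ?L \<union> {{Center}}) \<inter> ?P = {}"
    "(Pow ?L \<union> {{Center}} \<union> ?P) \<inter> ?T = {}"
    using Center_notin_outer_vertices[of n] by auto
  have "finite (verts (friendship_graph n))"
    by (simp add: verts_friendship_graph finite_outer_vertices del: with_proj_simps)
  then have "visibility_polynomial (friendship_graph n) =
      (\<Sum>X | mutual_visibility_set (friendship_graph n) X. ?x ^ card X)"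
    by (simp add: visibility_polynomial_eq_sum monom_altdef)
  also have "{X. mutual_visibility_set (friendship_graph n) X} = Pow ?L \<union> {{Center}} \<union> ?P \<union> ?T"
    unfolding mutual_visibility_set_friendship_graph_iff by auto
  also have "(\<Sum>X\<in>Pow ?L \<union> {{Center}} \<union> ?P \<union> ?T. ?x ^ card X) =
      (\<Sum>X\<in>Pow ?L. ?x ^ card X) + (\<Sum>X\<in>{{Center}}. ?x ^ card X) +
      (\<Sum>X\<in>?P. ?x ^ card X) + (\<Sum>X\<in>?T. ?x ^ card X)"
    by (simp only: sum.union_disjoint disjoint finite_outer_vertices finite_Pow_iff finite_Un
        finite_imageI finite_atLeastAtMost finite.intros simp_thms)
  also have "(\<Sum>X\<in>Pow ?L. ?x ^ card X) = (1 + ?x) ^ (2 * n)"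
    by (simp only: sum_power_card_Pow finite_outer_vertices card_outer_vertices)
  \<comment> \<open>The set \<open>{Center, v}\<close> determines \<open>v\<close>, so the pairs are
    counted by the outer vertices; likewise the sets in \<open>?T\<close> are counted by the
    triangle index.\<close>
  also have "(\<Sum>X\<in>?P. ?x ^ card X) = (\<Sum>v\<in>?L. ?x ^ card {Center, v})"
    by (rule sum.reindex[unfolded o_def]) (auto simp: inj_on_def doubleton_eq_iff)
  also have "\<dots> = (\<Sum>v\<in>?L. ?x ^ 2)"
    by (rule sum.cong) (auto simp: outer_vertices_def numeral_2_eq_2)
  also have "\<dots> = of_nat (2 * n) * ?x ^ 2"
    by (simp only: sum_constant card_outer_vertices)
  also have "(\<Sum>X\<in>?T. ?x ^ card X) = (\<Sum>i\<in>{1..n}. ?x ^ card {Center, A i, B i})"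
    by (rule sum.reindex[unfolded o_def]) (auto simp: inj_on_def)
  also have "\<dots> = of_nat n * ?x ^ 3"
    by (simp add: numeral_3_eq_3)
  finally show ?thesis
    by simp
qed

end
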